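(* Let $(G,\cdot,B)$ be a Rota--Baxter group. Put $\lambda_a(b)=B(a)bB(a)^{-1}$ for $a,b\in G$. Then the map $$S\colon G\times G\to G\times G,\qquad S(a,b)=\bigl(\lambda_a(b),\,a^{\lambda_a(b)B(\lambda_a(b))}\bigr),$$ is a non-degenerate set-theoretical solution to the Yang--Baxter equation. Moreover, $S$ is involutive if and only if $ab=ba$ for all $a,b\in G$.
   Context: A Rota--Baxter group is a group $G$ endowed with a map $B\colon G\to G$ such that $B(g)B(h)=B(gB(g)hB(g)^{-1})$ for all $g,h\in G$. Notation: $x^y=y^{-1}xy$. A set-theoretical solution to the Yang--Baxter equation on a set $X$ is a bijective map $S\colon X\times X\to X\times X$ such that $(S\times\mathrm{id})(\mathrm{id}\times S)(S\times\mathrm{id})=(\mathrm{id}\times S)(S\times\mathrm{id})(\mathrm{id}\times S)$ as maps $X^3\to X^3$. Writing $S(x,y)=(\sigma_x(y),\tau_y(x))$, the solution is non-degenerate if $\sigma_x$ and $\tau_x$ are bijections of $X$ for every $x\in X$; it is involutive if $S^2=\mathrm{id}$. *)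

theory Defs
  imports "HOL-Algebra.Group"
begin

locale rota_baxter_group = group G for G (structure) +
  fixes B :: "'a \<Rightarrow> 'a"
  assumes B_closed: "B \<in> carrier G \<rightarrow> carrier G"
    and rota_baxter: "\<lbrakk>g \<in> carrier G; h \<in> carrier G\<rbrakk> \<Longrightarrow>
      B g \<otimes> B h = B (g \<otimes> B g \<otimes> h \<otimes> inv (B g))"

text \<open>Conjugation acts on the right: \<open>x\<^sup>y = y\<^sup>-\<^sup>1 x y\<close>.\<close>

definition group_conj :: "('a, 'b) monoid_scheme \<Rightarrow> 'a \<Rightarrow> 'a \<Rightarrow> 'a" where
  "group_conj G x y = inv\<^bsub>G\<^esub> y \<otimes>\<^bsub>G\<^esub> x \<otimes>\<^bsub>G\<^esub> y"

definition rb_lambda :: "('a, 'b) monoid_scheme \<Rightarrow> ('a \<Rightarrow> 'a) \<Rightarrow> 'a \<Rightarrow> 'a \<Rightarrow> 'a" where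
  "rb_lambda G B a b = B a \<otimes>\<^bsub>G\<^esub> b \<otimes>\<^bsub>G\<^esub> inv\<^bsub>G\<^esub> (B a)"

definition rb_solution :: "('a, 'b) monoid_scheme \<Rightarrow> ('a \<Rightarrow> 'a) \<Rightarrow> 'a \<times> 'a \<Rightarrow> 'a \<times> 'a" where
  "rb_solution G B = (\<lambda>(a, b).
     (rb_lambda G B a b,
      group_conj G a (rb_lambda G B a b \<otimes>\<^bsub>G\<^esub> B (rb_lambda G B a b))))"

text \<open>
  A map on \<open>X \<times> X\<close> is a function on the ambient type, constrained only on \<open>X \<times> X\<close>.
  Triples associate to the right, so \<open>S \<times> id\<close> has to be spelled out, whereas \<open>id \<times> S\<close> is
  a plain product of maps.
\<close>

definition on_12 :: "('a \<times> 'a \<Rightarrow> 'a \<times> 'a) \<Rightarrow> 'a \<times> 'a \<times> 'a \<Rightarrow> 'a \<times> 'a \<times> 'a" where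
  "on_12 S = (\<lambda>(x, y, z). (fst (S (x, y)), snd (S (x, y)), z))"

definition on_23 :: "('a \<times> 'a \<Rightarrow> 'a \<times> 'a) \<Rightarrow> 'a \<times> 'a \<times> 'a \<Rightarrow> 'a \<times> 'a \<times> 'a" where
  "on_23 S = map_prod id S"

definition ybe_solution :: "'a set \<Rightarrow> ('a \<times> 'a \<Rightarrow> 'a \<times> 'a) \<Rightarrow> bool" where
  "ybe_solution X S \<longleftrightarrow>
     bij_betw S (X \<times> X) (X \<times> X) \<and>
     (\<forall>t \<in> X \<times> X \<times> X.
        (on_12 S \<circ> on_23 S \<circ> on_12 S) t = (on_23 S \<circ> on_12 S \<circ> on_23 S) t)"

text \<open>
  With \<open>S (x, y) = (\<sigma>\<^sub>x y, \<tau>\<^sub>y x)\<close>: the map \<open>\<sigma>\<^sub>x\<close> is \<open>y \<mapsto> fst (S (x, y))\<close>, and \<open>\<tau>\<^sub>x\<close> is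
  \<open>y \<mapsto> snd (S (y, x))\<close>.
\<close>

definition nondegenerate :: "'a set \<Rightarrow> ('a \<times> 'a \<Rightarrow> 'a \<times> 'a) \<Rightarrow> bool" where
  "nondegenerate X S \<longleftrightarrow>
     (\<forall>x \<in> X. bij_betw (\<lambda>y. fst (S (x, y))) X X \<and> bij_betw (\<lambda>y. snd (S (y, x))) X X)"

definition involutive :: "'a set \<Rightarrow> ('a \<times> 'a \<Rightarrow> 'a \<times> 'a) \<Rightarrow> bool" where
  "involutive X S \<longleftrightarrow> (\<forall>p \<in> X \<times> X. S (S p) = p)"

end

theory Submission
  imports Defs
begin

text \<open>
  A Rota--Baxter operator turns \<open>G\<close> into a skew left brace. Since \<open>\<lambda>\<^sub>a\<close> is conjugation by
  \<open>B(a)\<close>, it is an automorphism of \<open>G\<close>, and the Rota--Baxter identity says precisely that \<open>B\<close>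
  takes the second product \<open>a \<circ> b = a \<lambda>\<^sub>a(b)\<close> to the product of \<open>G\<close>. Hence
  \<open>\<lambda>\<^sub>a\<^sub>\<circ>\<^sub>b = \<lambda>\<^sub>a \<lambda>\<^sub>b\<close>, and this makes \<open>(G, \<circ>)\<close> a group acting on \<open>G\<close> by
  \<open>\<lambda>\<close>.

  Write \<open>\<tau>\<^sub>b(a)\<close> for the second component of \<open>S(a, b)\<close>. The conjugation formula is designed so that
  \<open>\<lambda>\<^sub>a(b) \<circ> \<tau>\<^sub>b(a) = a \<lambda>\<^sub>a(b) = a \<circ> b\<close> (\<open>lam_circ_tau\<close>): the map \<open>S\<close> refactorises a
  \<open>\<circ>\<close>-product, with \<open>\<lambda>\<^sub>a(b)\<close> as its new left factor. From this and the action law one obtains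
  \<open>\<lambda>\<^sub>a(b \<circ> c) = \<lambda>\<^sub>a(b) \<circ> \<lambda>\<^sub>e(c)\<close> with \<open>e = \<tau>\<^sub>b(a)\<close> (\<open>lam_circ\<close>), and left
  cancellation in \<open>(G, \<circ>)\<close> then shows that \<open>\<tau>\<close> is a right action, \<open>\<tau>\<^sub>b\<^sub>\<circ>\<^sub>c = \<tau>\<^sub>c \<tau>\<^sub>b\<close>
  (\<open>tau_circ\<close>). So \<open>\<lambda>\<^sub>a\<close> and \<open>\<tau>\<^sub>b\<close> are bijective, which is non-degeneracy.

  In the Yang--Baxter equation at \<open>(a, b, c)\<close> the first components agree because \<open>\<lambda>\<close> is an action
  and the third ones because \<open>\<tau>\<close> is. In each of the two triples the \<open>\<circ>\<close>-product of the first two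
  components is \<open>\<lambda>\<^sub>a(b \<circ> c)\<close>, so the second components agree by cancellation.

  Finally, the first component of \<open>S(S(a, b))\<close> is \<open>a\<close> conjugated by \<open>\<lambda>\<^sub>a(b)\<close>. For fixed \<open>a\<close>
  the element \<open>\<lambda>\<^sub>a(b)\<close> is arbitrary, so involutivity forces \<open>G\<close> to be abelian; in the abelian case
  \<open>S\<close> is the flip.
\<close>

context rota_baxter_group
begin

section \<open>The second product and the automorphisms \<open>\<lambda>\<^sub>a\<close>\<close>

abbreviation lam :: "'a \<Rightarrow> 'a \<Rightarrow> 'a" where
  "lam \<equiv> rb_lambda G B"

definition circ :: "'a \<Rightarrow> 'a \<Rightarrow> 'a"  (infixl "\<circ>\<^sub>B" 70) where
  "a \<circ>\<^sub>B b = a \<otimes> lam a b"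

definition tau :: "'a \<Rightarrow> 'a \<Rightarrow> 'a" where
  "tau b a = group_conj G a (lam a b \<otimes> B (lam a b))"

lemma rb_solution_eq: "rb_solution G B (a, b) = (lam a b, tau b a)"
  by (simp add: rb_solution_def tau_def)

lemma B_carrier [simp]: "a \<in> carrier G \<Longrightarrow> B a \<in> carrier G"
  using B_closed by auto

lemma lam_closed [simp]: "\<lbrakk>a \<in> carrier G; b \<in> carrier G\<rbrakk> \<Longrightarrow> lam a b \<in> carrier G"
  by (simp add: rb_lambda_def)

lemma circ_closed [simp]: "\<lbrakk>a \<in> carrier G; b \<in> carrier G\<rbrakk> \<Longrightarrow> a \<circ>\<^sub>B b \<in> carrier G"
  by (simp add: circ_def)

lemma tau_closed [simp]: "\<lbrakk>a \<in> carrier G; b \<in> carrier G\<rbrakk> \<Longrightarrow> tau b a \<in> carrier G"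
  by (simp add: tau_def group_conj_def)

lemma mult_inv_cancel [simp]:
  assumes "x \<in> carrier G" "y \<in> carrier G"
  shows "x \<otimes> (inv x \<otimes> y) = y" "inv x \<otimes> (x \<otimes> y) = y"
  using assms by (simp_all flip: m_assoc)

lemma lam_mult:
  "\<lbrakk>a \<in> carrier G; b \<in> carrier G; c \<in> carrier G\<rbrakk> \<Longrightarrow> lam a (b \<otimes> c) = lam a b \<otimes> lam a c"
  by (simp add: rb_lambda_def m_assoc)

text \<open>The Rota--Baxter identity, read as a homomorphism property.\<close>

lemma B_circ: "\<lbrakk>a \<in> carrier G; b \<in> carrier G\<rbrakk> \<Longrightarrow> B (a \<circ>\<^sub>B b) = B a \<otimes> B b"
  by (simp add: circ_def rb_lambda_def rota_baxter m_assoc)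

lemma lam_of_circ:
  "\<lbrakk>a \<in> carrier G; b \<in> carrier G; c \<in> carrier G\<rbrakk> \<Longrightarrow> lam (a \<circ>\<^sub>B b) c = lam a (lam b c)"
  by (simp add: rb_lambda_def B_circ inv_mult_group m_assoc)

lemma bij_betw_lam: "a \<in> carrier G \<Longrightarrow> bij_betw (lam a) (carrier G) (carrier G)"
  by (rule bij_betw_byWitness[where f' = "\<lambda>c. inv (B a) \<otimes> c \<otimes> B a"])
    (auto simp: rb_lambda_def m_assoc)

section \<open>The second group structure\<close>

lemma circ_assoc:
  assumes "a \<in> carrier G" "b \<in> carrier G" "c \<in> carrier G"
  shows "a \<circ>\<^sub>B b \<circ>\<^sub>B c = a \<circ>\<^sub>B (b \<circ>\<^sub>B c)"
proof -
  have "a \<circ>\<^sub>B b \<circ>\<^sub>B c = a \<circ>\<^sub>B b \<otimes> lam a (lam b c)"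
    using assms by (simp add: circ_def[of "a \<circ>\<^sub>B b"] lam_of_circ)
  also have "\<dots> = a \<circ>\<^sub>B (b \<circ>\<^sub>B c)"
    using assms by (simp add: circ_def lam_mult m_assoc)
  finally show ?thesis .
qed

lemma circ_left_cancel:
  assumes "a \<in> carrier G" "b \<in> carrier G" "c \<in> carrier G" and "a \<circ>\<^sub>B b = a \<circ>\<^sub>B c"
  shows "b = c"
proof -
  have "lam a b = lam a c"
    using assms by (simp add: circ_def)
  thus ?thesis
    using bij_betw_lam[of a] assms by (metis bij_betw_imp_inj_on inj_onD)
qed

lemma lam_one [simp]: "a \<in> carrier G \<Longrightarrow> lam a \<one> = \<one>"
  by (simp add: rb_lambda_def)

lemma B_one: "B \<one> = \<one>"
proof -
  have "B \<one> \<otimes> B \<one> = B \<one>"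
    using B_circ[of \<one> \<one>] by (simp add: circ_def)
  thus ?thesis
    by simp
qed

lemma circ_one [simp]: "a \<in> carrier G \<Longrightarrow> a \<circ>\<^sub>B \<one> = a"
  by (simp add: circ_def)

lemma one_circ [simp]: "a \<in> carrier G \<Longrightarrow> \<one> \<circ>\<^sub>B a = a"
  by (simp add: circ_def rb_lambda_def B_one)

lemma circ_right_inverse:
  assumes "a \<in> carrier G"
  obtains b where "b \<in> carrier G" "a \<circ>\<^sub>B b = \<one>"
proof -
  obtain b where "b \<in> carrier G" "lam a b = inv a"
    using bij_betw_lam[OF assms] assms inv_closed[OF assms] unfolding bij_betw_def
    by (metis imageE)
  thus thesis
    using assms that[of b] by (simp add: circ_def)
qed

text \<open>
  In a monoid where every element has a right inverse, right inverses are left inverses. Here this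
  follows from left cancellation: \<open>a \<circ> (b \<circ> a) = a = a \<circ> \<one>\<close>.
\<close>

lemma circ_inverse:
  assumes "a \<in> carrier G"
  obtains b where "b \<in> carrier G" "a \<circ>\<^sub>B b = \<one>" "b \<circ>\<^sub>B a = \<one>"
proof -
  obtain b where b: "b \<in> carrier G" "a \<circ>\<^sub>B b = \<one>"
    using circ_right_inverse[OF assms] .
  have "a \<circ>\<^sub>B (b \<circ>\<^sub>B a) = a \<circ>\<^sub>B \<one>"
    using assms b by (simp flip: circ_assoc)
  hence "b \<circ>\<^sub>B a = \<one>"
    using assms b by (intro circ_left_cancel[of a "b \<circ>\<^sub>B a" \<one>]) simp_all
  thus thesis
    using b that by blast
qed

section \<open>The two actions\<close>

text \<open>
  Conjugating by \<open>c B(c)\<close> for \<open>c = \<lambda>\<^sub>a(b)\<close> means conjugating by \<open>c\<close> and then applying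
  \<open>\<lambda>\<^sub>c\<^sup>-\<^sup>1\<close>, so \<open>\<lambda>\<^sub>c\<close> undoes the second step.
\<close>

lemma lam_tau:
  "\<lbrakk>a \<in> carrier G; b \<in> carrier G\<rbrakk> \<Longrightarrow>
     lam (lam a b) (tau b a) = group_conj G a (lam a b)"
  unfolding rb_lambda_def[of G B "lam a b"]
  by (simp add: tau_def group_conj_def inv_mult_group m_assoc)

lemma lam_circ_tau:
  assumes "a \<in> carrier G" "b \<in> carrier G"
  shows "lam a b \<circ>\<^sub>B tau b a = a \<circ>\<^sub>B b"
  using assms by (simp add: circ_def lam_tau group_conj_def m_assoc)

lemma lam_lam_tau:
  assumes "a \<in> carrier G" "b \<in> carrier G" "c \<in> carrier G"
  shows "lam (lam a b) (lam (tau b a) c) = lam a (lam b c)"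
  using assms by (simp add: lam_circ_tau flip: lam_of_circ)

text \<open>
  Although \<open>\<lambda>\<^sub>a\<close> is no endomorphism of \<open>(G, \<circ>)\<close>, it fails to be one only by replacing \<open>\<lambda>\<^sub>a\<close>
  with \<open>\<lambda>\<^sub>e\<close>, \<open>e = \<tau>\<^sub>b(a)\<close>, on the second factor.
\<close>

lemma lam_circ:
  assumes "a \<in> carrier G" "b \<in> carrier G" "c \<in> carrier G"
  shows "lam a (b \<circ>\<^sub>B c) = lam a b \<circ>\<^sub>B lam (tau b a) c"
  using assms by (simp add: circ_def lam_mult lam_lam_tau)

text \<open>
  Both sides satisfy \<open>\<lambda>\<^sub>a(b \<circ> c) \<circ> x = a \<circ> b \<circ> c\<close>.
\<close>

lemma tau_circ:
  assumes "a \<in> carrier G" "b \<in> carrier G" "c \<in> carrier G"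
  shows "tau (b \<circ>\<^sub>B c) a = tau c (tau b a)"
proof (rule circ_left_cancel)
  have "lam a (b \<circ>\<^sub>B c) \<circ>\<^sub>B tau (b \<circ>\<^sub>B c) a = a \<circ>\<^sub>B b \<circ>\<^sub>B c"
    using assms by (simp add: lam_circ_tau circ_assoc)
  also have "\<dots> = lam a b \<circ>\<^sub>B (tau b a \<circ>\<^sub>B c)"
    using assms by (simp add: lam_circ_tau flip: circ_assoc)
  also have "\<dots> = lam a b \<circ>\<^sub>B (lam (tau b a) c \<circ>\<^sub>B tau c (tau b a))"
    using assms by (simp add: lam_circ_tau)
  also have "\<dots> = lam a (b \<circ>\<^sub>B c) \<circ>\<^sub>B tau c (tau b a)"
    using assms by (simp add: lam_circ circ_assoc)
  finally show "lam a (b \<circ>\<^sub>B c) \<circ>\<^sub>B tau (b \<circ>\<^sub>B c) a = lam a (b \<circ>\<^sub>B c) \<circ>\<^sub>B tau c (tau b a)" .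
qed (use assms in simp_all)

lemma tau_one: "a \<in> carrier G \<Longrightarrow> tau \<one> a = a"
  using lam_circ_tau[of a \<one>] by simp

lemma bij_betw_tau:
  assumes "b \<in> carrier G"
  shows "bij_betw (tau b) (carrier G) (carrier G)"
proof -
  obtain b' where b': "b' \<in> carrier G" "b \<circ>\<^sub>B b' = \<one>" "b' \<circ>\<^sub>B b = \<one>"
    using circ_inverse[OF assms] .
  show ?thesis
    by (rule bij_betw_byWitness[where f' = "tau b'"])
      (use assms b' in \<open>auto simp: tau_one simp flip: tau_circ\<close>)
qed

section \<open>The solution\<close>

lemma nondegenerate_rb_solution: "nondegenerate (carrier G) (rb_solution G B)"
  by (simp add: nondegenerate_def rb_solution_eq bij_betw_lam bij_betw_tau)

text \<open>
  If \<open>S(a, b) = (c, d)\<close>, then \<open>a c = c \<circ> d\<close>, which recovers first \<open>a\<close> and then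
  \<open>b = \<lambda>\<^sub>a\<^sup>-\<^sup>1(c)\<close>.
\<close>

lemma bij_betw_rb_solution:
  "bij_betw (rb_solution G B) (carrier G \<times> carrier G) (carrier G \<times> carrier G)"
  unfolding bij_betw_def
proof (intro conjI inj_onI equalityI subsetI)
  fix p q
  assume p: "p \<in> carrier G \<times> carrier G" and q: "q \<in> carrier G \<times> carrier G"
    and eq: "rb_solution G B p = rb_solution G B q"
  obtain a b a' b' where ab: "p = (a, b)" "q = (a', b')"
    by (cases p, cases q)
  have carr: "a \<in> carrier G" "b \<in> carrier G" "a' \<in> carrier G" "b' \<in> carrier G"
    using p q ab by auto
  have c: "lam a b = lam a' b'" and "tau b a = tau b' a'"
    using eq by (auto simp: ab rb_solution_eq)
  hence "a \<circ>\<^sub>B b = a' \<circ>\<^sub>B b'"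
    using carr by (metis lam_circ_tau)
  hence "a = a'"
    using carr c by (simp add: circ_def)
  moreover have "b = b'"
    using bij_betw_lam[of a] carr c \<open>a = a'\<close> by (metis bij_betw_imp_inj_on inj_onD)
  ultimately show "p = q"
    by (simp add: ab)
next
  fix p assume "p \<in> carrier G \<times> carrier G"
  then obtain c d where p: "p = (c, d)" and carr: "c \<in> carrier G" "d \<in> carrier G"
    by auto
  define a where "a = (c \<circ>\<^sub>B d) \<otimes> inv c"
  have a: "a \<in> carrier G"
    using carr by (simp add: a_def)
  obtain b where b: "b \<in> carrier G" "lam a b = c"
    using bij_betw_lam[OF a] carr unfolding bij_betw_def by (metis imageE)
  have "c \<circ>\<^sub>B tau b a = a \<otimes> c"
    using lam_circ_tau[of a b] a b by (simp add: circ_def[of a])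
  also have "\<dots> = c \<circ>\<^sub>B d"
    using carr by (simp add: a_def m_assoc)
  finally have "tau b a = d"
    using a b carr circ_left_cancel[of c] by simp
  hence "p = rb_solution G B (a, b)"
    using b by (simp add: p rb_solution_eq)
  thus "p \<in> rb_solution G B ` (carrier G \<times> carrier G)"
    using a b by blast
qed (auto simp: rb_solution_eq)

lemma yang_baxter_rb_solution:
  assumes "a \<in> carrier G" "b \<in> carrier G" "c \<in> carrier G"
  defines "S \<equiv> rb_solution G B"
  shows "(on_12 S \<circ> on_23 S \<circ> on_12 S) (a, b, c) = (on_23 S \<circ> on_12 S \<circ> on_23 S) (a, b, c)"
proof -
  define x where "x = lam (tau b a) c"
  define y where "y = tau (lam b c) a"
  have carr: "x \<in> carrier G" "y \<in> carrier G"
    using assms by (simp_all add: x_def y_def)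
  have first: "lam (lam a b) x = lam a (lam b c)"
    using assms by (simp add: x_def lam_lam_tau)
  \<comment> \<open>both sides are \<open>\<tau>\<^sub>b\<^sub>\<circ>\<^sub>c(a)\<close>, and \<open>b \<circ> c = \<lambda>\<^sub>b(c) \<circ> \<tau>\<^sub>c(b)\<close>\<close>
  have third: "tau c (tau b a) = tau (tau c b) y"
    using assms by (simp add: y_def lam_circ_tau flip: tau_circ)
  have second: "tau x (lam a b) = lam y (tau c b)"
  proof (rule circ_left_cancel)
    have "lam (lam a b) x \<circ>\<^sub>B tau x (lam a b) = lam a b \<circ>\<^sub>B x"
      using assms carr by (simp add: lam_circ_tau)
    also have "\<dots> = lam a (b \<circ>\<^sub>B c)"
      using assms by (simp add: x_def lam_circ)
    also have "\<dots> = lam a (lam b c \<circ>\<^sub>B tau c b)"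
      using assms by (simp add: lam_circ_tau)
    also have "\<dots> = lam (lam a b) x \<circ>\<^sub>B lam y (tau c b)"
      using assms by (simp add: lam_circ first y_def)
    finally show "lam (lam a b) x \<circ>\<^sub>B tau x (lam a b) = lam (lam a b) x \<circ>\<^sub>B lam y (tau c b)" .
  qed (use assms carr in simp_all)
  show ?thesis
    using first second third
    by (simp add: S_def on_12_def on_23_def rb_solution_eq x_def y_def)
qed

lemma involutive_rb_solution_iff:
  "involutive (carrier G) (rb_solution G B) \<longleftrightarrow>
     (\<forall>a \<in> carrier G. \<forall>b \<in> carrier G. a \<otimes> b = b \<otimes> a)"
proof (intro iffI ballI)
  fix a c
  assume inv: "involutive (carrier G) (rb_solution G B)"
    and carr: "a \<in> carrier G" "c \<in> carrier G"
  obtain b where b: "b \<in> carrier G" "lam a b = c"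
    using bij_betw_lam[OF carr(1)] carr unfolding bij_betw_def by (metis imageE)
  have "lam (lam a b) (tau b a) = a"
    using inv carr b by (auto simp: involutive_def rb_solution_eq)
  hence "inv c \<otimes> a \<otimes> c = a"
    using carr b lam_tau[of a b] by (simp add: group_conj_def)
  hence "c \<otimes> (inv c \<otimes> (a \<otimes> c)) = c \<otimes> a"
    using carr by (simp add: m_assoc)
  thus "a \<otimes> c = c \<otimes> a"
    using carr by simp
next
  assume comm: "\<forall>a \<in> carrier G. \<forall>b \<in> carrier G. a \<otimes> b = b \<otimes> a"
  have lam: "lam a b = b" if "a \<in> carrier G" "b \<in> carrier G" for a b
    using that comm[rule_format, of "B a" b] by (simp add: rb_lambda_def m_assoc)
  have conj: "group_conj G a c = a" if "a \<in> carrier G" "c \<in> carrier G" for a c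
    using that comm[rule_format, of a c] by (simp add: group_conj_def m_assoc)
  have "tau b a = a" if "a \<in> carrier G" "b \<in> carrier G" for a b
    using that by (simp add: tau_def conj)
  thus "involutive (carrier G) (rb_solution G B)"
    by (auto simp: involutive_def rb_solution_eq lam)
qed

end

theorem theorem6p1:
  fixes G :: "('a, 'b) monoid_scheme" (structure)
    and B :: "'a \<Rightarrow> 'a"
  assumes "rota_baxter_group G B"
  shows "ybe_solution (carrier G) (rb_solution G B)
      \<and> nondegenerate (carrier G) (rb_solution G B)
      \<and> (involutive (carrier G) (rb_solution G B)
          \<longleftrightarrow> (\<forall>a \<in> carrier G. \<forall>b \<in> carrier G. a \<otimes> b = b \<otimes> a))"
proof -
  interpret rota_baxter_group G B
    by fact
  show ?thesis
    using bij_betw_rb_solution yang_baxter_rb_solution nondegenerate_rb_solution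
      involutive_rb_solution_iff
    unfolding ybe_solution_def by auto
qed

end
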